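(* Let a coherent system of sizes $(U,\mathcal{Y},\mathcal{I})$ be given, where $U$ is the set of models of a classical propositional language. Consider the properties $(\mathcal{I}_\omega)$: $A,B\in\mathcal{I}(X)\Rightarrow A\cup B\in\mathcal{I}(X)$; $(eM\mathcal{I})$: $X\subseteq Y\Rightarrow\mathcal{I}(X)\subseteq\mathcal{I}(Y)$; $(eM\mathcal{F})$: $X\subseteq Y\Rightarrow\mathcal{F}(Y)\cap\mathcal{P}(X)\subseteq\mathcal{F}(X)$. Then: (1) $(\mathcal{I}_\omega)$ and $(eM\mathcal{I})$ together imply $(OR_\omega)$: $\alpha\mathrel{|\!\sim}\beta,\ \alpha'\mathrel{|\!\sim}\beta\Rightarrow\alpha\vee\alpha'\mathrel{|\!\sim}\beta$. (2) $(\mathcal{I}_\omega)$ and $(eM\mathcal{I})$ together imply $(\mathcal{M}^+_\omega)(1)$: for $A\subseteq X\subseteq Y$, $A\in\mathcal{F}(X),\ X\in\mathcal{M}^+(Y)\Rightarrow A\in\mathcal{M}^+(Y)$. (3) $(\mathcal{I}_\omega)$ and $(eM\mathcal{F})$ together imply $(\mathcal{M}^+_\omega)(2)$: for $A\subseteq X\subseteq Y$, $A\in\mathcal{M}^+(X),\ X\in\mathcal{F}(Y)\Rightarrow A\in\mathcal{M}^+(Y)$. (4) $(\mathcal{I}_\omega)$ and $(eM\mathcal{I})$ together imply $(\mathcal{M}^+_\omega)(3)$: for $A\subseteq X\subseteq Y$, $A\in\mathcal{F}(X),\ X\in\mathcal{F}(Y)\Rightarrow A\in\mathcal{F}(Y)$.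 (5) $(\mathcal{I}_\omega)$ and $(eM\mathcal{F})$ together imply $(\mathcal{M}^+_\omega)(4)$: $A,B\in\mathcal{I}(X)\Rightarrow A-B\in\mathcal{I}(X-B)$; and thus they also imply $(CM_\omega)$: $\alpha\mathrel{|\!\sim}\beta,\ \alpha\mathrel{|\!\sim}\beta'\Rightarrow\alpha\wedge\beta\mathrel{|\!\sim}\beta'$.
   Context: A coherent system of sizes consists of a set $U$ (the universe), a family $\mathcal{Y}\subseteq\mathcal{P}(U)$ with $\emptyset\notin\mathcal{Y}$, and for each $X\in\mathcal{Y}$ a family $\mathcal{I}(X)\subseteq\mathcal{P}(X)$ (the "small" subsets of $X$). Dually, $\mathcal{F}(X):=\{A\subseteq X: X-A\in\mathcal{I}(X)\}$ (the "big" subsets), and $\mathcal{M}^+(X):=\mathcal{P}(X)-\mathcal{I}(X)$ (the subsets that are not small). No further properties of $\mathcal{I}(X)$ are assumed unless stated. For propositional formulas, $M(\phi)\subseteq U$ is the set of models of $\phi$, and $\alpha\mathrel{|\!\sim}\beta$ means $M(\alpha\wedge\beta)\in\mathcal{F}(M(\alpha))$. Convention: every rule is read as universally quantified over all sets, respectively formulas, such that each set $X$ at which $\mathcal{I}(X)$, $\mathcal{F}(X)$ or $\mathcal{M}^+(X)$ is evaluated (in particular $M(\alpha)$ for each $\alpha$ to the left of $\mathrel{|\!\sim}$) belongs to $\mathcal{Y}$. *)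

theory Defs
  imports Main
begin

text \<open>
  The universe of classical models is the full set of valuations
  \<open>UNIV :: ('p \<Rightarrow> bool) set\<close>, where \<open>'p\<close> is the type of propositional variables.
\<close>

datatype 'p form =
    Atom 'p
  | Bot
  | Neg "'p form"
  | And "'p form" "'p form"
  | Or "'p form" "'p form"
  | Imp "'p form" "'p form"

primrec sat :: "('p \<Rightarrow> bool) \<Rightarrow> 'p form \<Rightarrow> bool" where
  "sat v (Atom p) \<longleftrightarrow> v p"
| "sat v Bot \<longleftrightarrow> False"
| "sat v (Neg \<phi>) \<longleftrightarrow> \<not> sat v \<phi>"
| "sat v (And \<phi> \<psi>) \<longleftrightarrow> sat v \<phi> \<and> sat v \<psi>"
| "sat v (Or \<phi> \<psi>) \<longleftrightarrow> sat v \<phi> \<or> sat v \<psi>"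
| "sat v (Imp \<phi> \<psi>) \<longleftrightarrow> (sat v \<phi> \<longrightarrow> sat v \<psi>)"

definition models :: "'p form \<Rightarrow> ('p \<Rightarrow> bool) set" where
  "models \<phi> = {v. sat v \<phi>}"

text \<open>
  The family \<open>I X\<close> is meaningful only for \<open>X \<in> \<Y>\<close>; the values of the total function \<open>I\<close>
  at other sets are unconstrained, and every rule below is restricted so as not to use them.
\<close>

locale coherent_system =
  fixes U :: "'u set"
    and \<Y> :: "'u set set"
    and I :: "'u set \<Rightarrow> 'u set set"
  assumes family_subset: "\<Y> \<subseteq> Pow U"
    and empty_notin: "{} \<notin> \<Y>"
    and small_subset: "X \<in> \<Y> \<Longrightarrow> I X \<subseteq> Pow X"

definition big :: "('u set \<Rightarrow> 'u set set) \<Rightarrow> 'u set \<Rightarrow> 'u set set" where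
  "big I X = {A. A \<subseteq> X \<and> X - A \<in> I X}"

definition not_small :: "('u set \<Rightarrow> 'u set set) \<Rightarrow> 'u set \<Rightarrow> 'u set set" where
  "not_small I X = Pow X - I X"

definition nm_conseq ::
  "(('p \<Rightarrow> bool) set \<Rightarrow> ('p \<Rightarrow> bool) set set) \<Rightarrow> 'p form \<Rightarrow> 'p form \<Rightarrow> bool" where
  "nm_conseq I \<alpha> \<beta> \<longleftrightarrow> models (And \<alpha> \<beta>) \<in> big I (models \<alpha>)"

definition I_omega :: "'u set set \<Rightarrow> ('u set \<Rightarrow> 'u set set) \<Rightarrow> bool" where
  "I_omega \<Y> I \<longleftrightarrow> (\<forall>X\<in>\<Y>. \<forall>A B. A \<in> I X \<longrightarrow> B \<in> I X \<longrightarrow> A \<union> B \<in> I X)"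

definition eM_I :: "'u set set \<Rightarrow> ('u set \<Rightarrow> 'u set set) \<Rightarrow> bool" where
  "eM_I \<Y> I \<longleftrightarrow> (\<forall>X\<in>\<Y>. \<forall>Y\<in>\<Y>. X \<subseteq> Y \<longrightarrow> I X \<subseteq> I Y)"

definition eM_F :: "'u set set \<Rightarrow> ('u set \<Rightarrow> 'u set set) \<Rightarrow> bool" where
  "eM_F \<Y> I \<longleftrightarrow> (\<forall>X\<in>\<Y>. \<forall>Y\<in>\<Y>. X \<subseteq> Y \<longrightarrow> big I Y \<inter> Pow X \<subseteq> big I X)"

definition OR_omega ::
  "('p \<Rightarrow> bool) set set \<Rightarrow> (('p \<Rightarrow> bool) set \<Rightarrow> ('p \<Rightarrow> bool) set set) \<Rightarrow> bool" where
  "OR_omega \<Y> I \<longleftrightarrow>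
    (\<forall>\<alpha> \<alpha>' \<beta>. models \<alpha> \<in> \<Y> \<longrightarrow> models \<alpha>' \<in> \<Y> \<longrightarrow> models (Or \<alpha> \<alpha>') \<in> \<Y> \<longrightarrow>
      nm_conseq I \<alpha> \<beta> \<longrightarrow> nm_conseq I \<alpha>' \<beta> \<longrightarrow> nm_conseq I (Or \<alpha> \<alpha>') \<beta>)"

definition CM_omega ::
  "('p \<Rightarrow> bool) set set \<Rightarrow> (('p \<Rightarrow> bool) set \<Rightarrow> ('p \<Rightarrow> bool) set set) \<Rightarrow> bool" where
  "CM_omega \<Y> I \<longleftrightarrow>
    (\<forall>\<alpha> \<beta> \<beta>'. models \<alpha> \<in> \<Y> \<longrightarrow> models (And \<alpha> \<beta>) \<in> \<Y> \<longrightarrow>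
      nm_conseq I \<alpha> \<beta> \<longrightarrow> nm_conseq I \<alpha> \<beta>' \<longrightarrow> nm_conseq I (And \<alpha> \<beta>) \<beta>')"

definition M_plus_omega_1 :: "'u set set \<Rightarrow> ('u set \<Rightarrow> 'u set set) \<Rightarrow> bool" where
  "M_plus_omega_1 \<Y> I \<longleftrightarrow>
    (\<forall>X\<in>\<Y>. \<forall>Y\<in>\<Y>. \<forall>A. A \<subseteq> X \<longrightarrow> X \<subseteq> Y \<longrightarrow>
      A \<in> big I X \<longrightarrow> X \<in> not_small I Y \<longrightarrow> A \<in> not_small I Y)"

definition M_plus_omega_2 :: "'u set set \<Rightarrow> ('u set \<Rightarrow> 'u set set) \<Rightarrow> bool" where
  "M_plus_omega_2 \<Y> I \<longleftrightarrow>
    (\<forall>X\<in>\<Y>. \<forall>Y\<in>\<Y>. \<forall>A. A \<subseteq> X \<longrightarrow> X \<subseteq> Y \<longrightarrow>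
      A \<in> not_small I X \<longrightarrow> X \<in> big I Y \<longrightarrow> A \<in> not_small I Y)"

definition M_plus_omega_3 :: "'u set set \<Rightarrow> ('u set \<Rightarrow> 'u set set) \<Rightarrow> bool" where
  "M_plus_omega_3 \<Y> I \<longleftrightarrow>
    (\<forall>X\<in>\<Y>. \<forall>Y\<in>\<Y>. \<forall>A. A \<subseteq> X \<longrightarrow> X \<subseteq> Y \<longrightarrow>
      A \<in> big I X \<longrightarrow> X \<in> big I Y \<longrightarrow> A \<in> big I Y)"

definition M_plus_omega_4 :: "'u set set \<Rightarrow> ('u set \<Rightarrow> 'u set set) \<Rightarrow> bool" where
  "M_plus_omega_4 \<Y> I \<longleftrightarrow>
    (\<forall>X\<in>\<Y>. \<forall>A B. X - B \<in> \<Y> \<longrightarrow>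
      A \<in> I X \<longrightarrow> B \<in> I X \<longrightarrow> A - B \<in> I (X - B))"

end

theory Submission
  imports Defs
begin

text \<open>
  Every implication is of the same kind: two exceptional sets are small at one and the same set,
  so by \<open>I_omega\<close> their union is small there, and this union is the exceptional set of the
  conclusion or leads to it by one more step. Note that a subset of a small set need not be small,
  so the sets involved have to match exactly.

  With \<open>eM_I\<close> smallness is carried \<^emph>\<open>up\<close>. The exceptional sets of the premises, small at a smaller
  set, are also small at the larger one, where they are joined:
  \<open>(M(\<alpha>) - M(\<beta>)) \<union> (M(\<alpha>') - M(\<beta>)) = M(\<alpha> \<or> \<alpha>') - M(\<beta>)\<close> for \<open>OR_omega\<close>,
  \<open>(X - A) \<union> (Y - X) = Y - A\<close> for \<open>M_plus_omega_3\<close>, and \<open>A \<union> (X - A) = X\<close> for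
  \<open>M_plus_omega_1\<close>, which is proved by contraposition: if \<open>A\<close> is small at \<open>Y\<close>, so is \<open>X\<close>.

  With \<open>eM_F\<close> smallness is carried \<^emph>\<open>down\<close>, but only for a set that already contains all points
  lost in the passage from \<open>Y\<close> to \<open>X\<close> (lemma \<open>small_restrict\<close>). If \<open>A\<close> and the lost part
  \<open>Y - X\<close> are both small, then their union satisfies this requirement, whence \<open>A \<inter> X\<close> is small
  at \<open>X\<close> (lemma \<open>small_Int\<close>). The contrapositive of \<open>M_plus_omega_2\<close> is this with
  \<open>A \<subseteq> X\<close>, and \<open>M_plus_omega_4\<close> is this with \<open>X\<close>, \<open>X - B\<close> in place of \<open>Y\<close>, \<open>X\<close>.
  Finally \<open>CM_omega\<close> is \<open>M_plus_omega_4\<close> for \<open>A = M(\<alpha>) - M(\<beta>')\<close> and \<open>B = M(\<alpha>) - M(\<beta>)\<close>.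
\<close>

lemma nm_conseq_iff_small: "nm_conseq I \<alpha> \<beta> \<longleftrightarrow> models \<alpha> - models \<beta> \<in> I (models \<alpha>)"
proof -
  have "models \<alpha> - models (And \<alpha> \<beta>) = models \<alpha> - models \<beta>" "models (And \<alpha> \<beta>) \<subseteq> models \<alpha>"
    by (auto simp: models_def)
  then show ?thesis
    by (simp add: nm_conseq_def big_def)
qed

lemma OR_omega_if_I_omega_eM_I:
  fixes \<Y> :: "('p \<Rightarrow> bool) set set"
  assumes "I_omega \<Y> I" "eM_I \<Y> I"
  shows "OR_omega \<Y> I"
  unfolding OR_omega_def nm_conseq_iff_small
proof (intro allI impI)
  fix \<alpha> \<alpha>' \<beta> :: "'p form"
  let ?Z = "models (Or \<alpha> \<alpha>')"
  assume "models \<alpha> \<in> \<Y>" "models \<alpha>' \<in> \<Y>" "?Z \<in> \<Y>"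
    and "models \<alpha> - models \<beta> \<in> I (models \<alpha>)" "models \<alpha>' - models \<beta> \<in> I (models \<alpha>')"
  moreover have "models \<alpha> \<subseteq> ?Z" "models \<alpha>' \<subseteq> ?Z"
    by (auto simp: models_def)
  ultimately have "models \<alpha> - models \<beta> \<in> I ?Z" "models \<alpha>' - models \<beta> \<in> I ?Z"
    using assms(2) unfolding eM_I_def by blast+
  then have "(models \<alpha> - models \<beta>) \<union> (models \<alpha>' - models \<beta>) \<in> I ?Z"
    using assms(1) \<open>?Z \<in> \<Y>\<close> unfolding I_omega_def by blast
  moreover have "(models \<alpha> - models \<beta>) \<union> (models \<alpha>' - models \<beta>) = ?Z - models \<beta>"
    by (auto simp: models_def)
  ultimately show "?Z - models \<beta> \<in> I ?Z"
    by simp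
qed

lemma M_plus_omega_1_if_I_omega_eM_I:
  assumes "I_omega \<Y> I" "eM_I \<Y> I"
  shows "M_plus_omega_1 \<Y> I"
  unfolding M_plus_omega_1_def
proof (intro ballI allI impI)
  fix X Y A
  assume XY: "X \<in> \<Y>" "Y \<in> \<Y>" "A \<subseteq> X" "X \<subseteq> Y" and "A \<in> big I X" and X: "X \<in> not_small I Y"
  then have "X - A \<in> I Y"
    using assms(2) unfolding eM_I_def big_def by blast
  then have "X \<in> I Y" if "A \<in> I Y"
    using assms(1) XY that unfolding I_omega_def by (metis Diff_partition)
  then show "A \<in> not_small I Y"
    using X XY unfolding not_small_def by blast
qed

lemma M_plus_omega_3_if_I_omega_eM_I:
  assumes "I_omega \<Y> I" "eM_I \<Y> I"
  shows "M_plus_omega_3 \<Y> I"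
  unfolding M_plus_omega_3_def
proof (intro ballI allI impI)
  fix X Y A
  assume XY: "X \<in> \<Y>" "Y \<in> \<Y>" "A \<subseteq> X" "X \<subseteq> Y" and "A \<in> big I X" "X \<in> big I Y"
  then have "X - A \<in> I Y" "Y - X \<in> I Y"
    using assms(2) unfolding eM_I_def big_def by blast+
  then have "(X - A) \<union> (Y - X) \<in> I Y"
    using assms(1) \<open>Y \<in> \<Y>\<close> unfolding I_omega_def by blast
  moreover have "(X - A) \<union> (Y - X) = Y - A"
    using XY by blast
  ultimately show "A \<in> big I Y"
    using XY unfolding big_def by auto
qed

context coherent_system
begin

text \<open>
  This is \<open>eM_F\<close> read through complements: \<open>Y - A\<close> is big at \<open>Y\<close> and lies within \<open>X\<close>, hence is
  big at \<open>X\<close>, and its complement in \<open>X\<close> is \<open>A \<inter> X\<close>.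
\<close>
lemma small_restrict:
  assumes "eM_F \<Y> I" "X \<in> \<Y>" "Y \<in> \<Y>" "X \<subseteq> Y" "A \<in> I Y" "Y - X \<subseteq> A"
  shows "A \<inter> X \<in> I X"
proof -
  have "A \<subseteq> Y"
    using small_subset assms by blast
  then have "Y - A \<in> big I Y"
    using assms by (simp add: big_def double_diff)
  then have "Y - A \<in> big I X"
    using assms unfolding eM_F_def by blast
  moreover have "X - (Y - A) = A \<inter> X"
    using assms by blast
  ultimately show ?thesis
    by (simp add: big_def)
qed

text \<open>
  Adding the small set \<open>Y - X\<close> to \<open>A\<close> does not change the trace on \<open>X\<close>, and makes the
  restriction to \<open>X\<close> possible.
\<close>
lemma small_Int:
  assumes "I_omega \<Y> I" "eM_F \<Y> I" "X \<in> \<Y>" "Y \<in> \<Y>" "X \<subseteq> Y" "A \<in> I Y" "Y - X \<in> I Y"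
  shows "A \<inter> X \<in> I X"
proof -
  have "A \<union> (Y - X) \<in> I Y"
    using assms unfolding I_omega_def by blast
  then have "(A \<union> (Y - X)) \<inter> X \<in> I X"
    using assms by (intro small_restrict) auto
  moreover have "(A \<union> (Y - X)) \<inter> X = A \<inter> X"
    by blast
  ultimately show ?thesis
    by simp
qed

lemma M_plus_omega_2_if_I_omega_eM_F:
  assumes "I_omega \<Y> I" "eM_F \<Y> I"
  shows "M_plus_omega_2 \<Y> I"
  unfolding M_plus_omega_2_def
proof (intro ballI allI impI)
  fix X Y A
  assume XY: "X \<in> \<Y>" "Y \<in> \<Y>" "A \<subseteq> X" "X \<subseteq> Y" and A: "A \<in> not_small I X" and "X \<in> big I Y"
  then have "A \<inter> X \<in> I X" if "A \<in> I Y"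
    using small_Int[OF assms, of X Y A] that by (simp add: big_def)
  moreover have "A \<inter> X = A"
    using XY by blast
  ultimately show "A \<in> not_small I Y"
    using A XY unfolding not_small_def by auto
qed

lemma M_plus_omega_4_if_I_omega_eM_F:
  assumes "I_omega \<Y> I" "eM_F \<Y> I"
  shows "M_plus_omega_4 \<Y> I"
  unfolding M_plus_omega_4_def
proof (intro ballI allI impI)
  fix X A B
  assume X: "X \<in> \<Y>" "X - B \<in> \<Y>" and AB: "A \<in> I X" "B \<in> I X"
  then have sub: "A \<subseteq> X" "B \<subseteq> X"
    using small_subset by blast+
  then have "A \<inter> (X - B) \<in> I (X - B)"
    using X AB by (intro small_Int[OF assms, of _ X]) (auto simp: double_diff)
  moreover have "A \<inter> (X - B) = A - B"
    using sub by blast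
  ultimately show "A - B \<in> I (X - B)"
    by simp
qed

end

lemma CM_omega_if_M_plus_omega_4:
  fixes \<Y> :: "('p \<Rightarrow> bool) set set"
  assumes "M_plus_omega_4 \<Y> I"
  shows "CM_omega \<Y> I"
  unfolding CM_omega_def nm_conseq_iff_small
proof (intro allI impI)
  fix \<alpha> \<beta> \<beta>' :: "'p form"
  let ?X = "models \<alpha>"
  let ?A = "?X - models \<beta>'" and ?B = "?X - models \<beta>"
  assume "?X \<in> \<Y>" "models (And \<alpha> \<beta>) \<in> \<Y>" "?B \<in> I ?X" "?A \<in> I ?X"
  moreover have eq: "?X - ?B = models (And \<alpha> \<beta>)"
    by (auto simp: models_def)
  ultimately have "?A - ?B \<in> I (?X - ?B)"
    using assms unfolding M_plus_omega_4_def by metis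
  moreover have "?A - ?B = models (And \<alpha> \<beta>) - models \<beta>'"
    by (auto simp: models_def)
  ultimately show "models (And \<alpha> \<beta>) - models \<beta>' \<in> I (models (And \<alpha> \<beta>))"
    by (simp add: eq)
qed

theorem fact3p8:
  fixes \<Y> :: "('p \<Rightarrow> bool) set set"
    and I :: "('p \<Rightarrow> bool) set \<Rightarrow> ('p \<Rightarrow> bool) set set"
  assumes "coherent_system (UNIV :: ('p \<Rightarrow> bool) set) \<Y> I"
  shows "(I_omega \<Y> I \<and> eM_I \<Y> I \<longrightarrow> OR_omega \<Y> I)
       \<and> (I_omega \<Y> I \<and> eM_I \<Y> I \<longrightarrow> M_plus_omega_1 \<Y> I)
       \<and> (I_omega \<Y> I \<and> eM_F \<Y> I \<longrightarrow> M_plus_omega_2 \<Y> I)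
       \<and> (I_omega \<Y> I \<and> eM_I \<Y> I \<longrightarrow> M_plus_omega_3 \<Y> I)
       \<and> (I_omega \<Y> I \<and> eM_F \<Y> I \<longrightarrow> M_plus_omega_4 \<Y> I \<and> CM_omega \<Y> I)"
proof -
  interpret coherent_system "UNIV :: ('p \<Rightarrow> bool) set" \<Y> I
    by (fact assms)
  show ?thesis
    using OR_omega_if_I_omega_eM_I M_plus_omega_1_if_I_omega_eM_I
      M_plus_omega_2_if_I_omega_eM_F M_plus_omega_3_if_I_omega_eM_I
      M_plus_omega_4_if_I_omega_eM_F CM_omega_if_M_plus_omega_4
    by blast
qed

end
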